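(* In the symplectic case $X^\jmath=G^\jmath(E)\cdot I_n$ is a unique $G^\jmath(E)$-orbit.
   Context: $E/F$ is a quadratic extension of non-archimedean local fields of characteristic zero with Galois involution $x\mapsto\bar x$. Symplectic case: $n$ is even and $\jmath\in\mathrm{GL}_n(F)$ satisfies ${}^t\jmath=-\jmath$. $G^\jmath(E)=\{g\in\mathrm{GL}_n(E):{}^tg\jmath g=\jmath\}$ and $X^\jmath=\{x\in G^\jmath(E):x\bar x=I_n\}$ with $G^\jmath(E)$-action $g\cdot x=gx\bar g^{-1}$. *)

theory Defs
  imports
    "HOL-Analysis.Abstract_Metric_Spaces"
    "HOL-Algebra.Group_Action"
    "Jordan_Normal_Form.Matrix"
begin

text \<open>
  A non-archimedean local field is a field that is complete with respect to a discrete nontrivial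
  non-archimedean absolute value and has finite residue field. Characteristic zero is built in via
  the sort. The absolute value need not be normalized.
\<close>

locale nonarch_local_field =
  fixes v :: "'a::field_char_0 \<Rightarrow> real"
  assumes nonneg: "0 \<le> v x"
    and eq_zero_iff: "v x = 0 \<longleftrightarrow> x = 0"
    and mult: "v (x * y) = v x * v y"
    and ultrametric: "v (x + y) \<le> max (v x) (v y)"
    and discrete: "\<exists>p. 0 < v p \<and> v p < 1 \<and> (\<forall>x. x \<noteq> 0 \<longrightarrow> (\<exists>k::int. v x = v p powi k))"
    and complete: "Metric_space.mcomplete UNIV (\<lambda>x y. v (x - y))"
    and finite_residue_field:
      "finite ({x. v x \<le> 1} // {(x, y). v x \<le> 1 \<and> v y \<le> 1 \<and> v (x - y) < 1})"

text \<open>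
  The field \<open>'e\<close> is a quadratic extension of \<open>'f\<close> along \<open>\<iota>\<close>, and \<open>\<sigma>\<close> is the nontrivial element
  of its Galois group. That \<open>w\<close> restricts to \<open>v\<close> says that the local field structures are
  compatible; this only fixes how the absolute value \<open>v\<close> is normalized in terms of \<open>w\<close>.
\<close>

locale quadratic_local_field_extension =
  F: nonarch_local_field v + E: nonarch_local_field w + emb: field_hom \<iota> + gal: field_hom \<sigma>
  for v :: "'f::field_char_0 \<Rightarrow> real"
    and w :: "'e::field_char_0 \<Rightarrow> real"
    and \<iota> :: "'f \<Rightarrow> 'e"
    and \<sigma> :: "'e \<Rightarrow> 'e" +
  assumes extends: "w (\<iota> a) = v a"
    and quadratic: "vector_space.dim (\<lambda>a x. \<iota> a * x) UNIV = 2"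
    and gal_bij: "bij \<sigma>"
    and gal_fixes: "\<sigma> (\<iota> a) = \<iota> a"
    and gal_nontrivial: "\<sigma> \<noteq> id"

definition GL :: "'a::field itself \<Rightarrow> nat \<Rightarrow> 'a mat monoid"
  where "GL ty n = units_of (ring_mat ty n ())"

text \<open>\<open>J\<close> is a matrix over the big field: in applications the image under \<open>\<iota>\<close> of a matrix over
  the small one.\<close>

definition form_group :: "nat \<Rightarrow> 'e::field mat \<Rightarrow> 'e mat monoid"
  where "form_group n J =
    (GL TYPE('e) n)\<lparr>carrier := {g \<in> carrier (GL TYPE('e) n). transpose_mat g * J * g = J}\<rparr>"

definition form_space :: "('e::field \<Rightarrow> 'e) \<Rightarrow> nat \<Rightarrow> 'e mat \<Rightarrow> 'e mat set"
  where "form_space \<sigma> n J = {x \<in> carrier (form_group n J). x * map_mat \<sigma> x = 1\<^sub>m n}"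

definition twisted_conj :: "('e::field \<Rightarrow> 'e) \<Rightarrow> nat \<Rightarrow> 'e mat \<Rightarrow> 'e mat \<Rightarrow> 'e mat"
  where "twisted_conj \<sigma> n g x = g * x * inv\<^bsub>GL TYPE('e) n\<^esub> (map_mat \<sigma> g)"

end

theory Submission
  imports Defs "Jordan_Normal_Form.Char_Poly" "Jordan_Normal_Form.Column_Operations"
begin

text \<open>
  The claim is that the first Galois cohomology set of the symplectic group is trivial. An element
  \<open>x\<close> of the form space is a cocycle. As a cocycle with values in the general linear group it is
  trivial by Hilbert's theorem 90 (\<open>hilbert_90_matrix\<close>): there is an invertible \<open>h\<close> over the big
  field with \<open>x = h \<sigma>(h)\<inverse>\<close>. The matrix \<open>h\<close> need not preserve the form \<open>J\<close>, but because \<open>x\<close>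
  does, the transported Gram matrix \<open>h\<^sup>T J h\<close> is fixed by \<open>\<sigma>\<close>, so it comes from an invertible
  skew-symmetric matrix \<open>k\<close> over the small field.

  This is where the symplectic case is special: over any field of characteristic zero two
  nondegenerate alternating forms of the same dimension are equivalent
  (\<open>symplectic_grams_congruent\<close>). So an invertible \<open>p\<close> over the small field satisfies
  \<open>p\<^sup>T k p = j\<close>. Now \<open>g = h p\<close> preserves \<open>J\<close>, and as \<open>\<sigma>\<close> fixes \<open>p\<close> one still has
  \<open>x = g \<sigma>(g)\<inverse>\<close>, which says that \<open>x\<close> lies in the orbit of the identity
  (\<open>cocycle_is_coboundary\<close>).

  The argument rests on two facts of Galois theory: \<open>\<sigma>\<close> is an involution
  (\<open>galois_involution\<close>), and its fixed field is the small field (\<open>fixed_imp_base\<close>). Both follow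
  because any moved element generates the extension and the dimension is two.
\<close>

section \<open>Invertible matrices\<close>

lemma matrix_inverse_exists:
  fixes A :: "'a::field mat"
  assumes "A \<in> carrier_mat n n" and "det A \<noteq> 0"
  obtains B where "B \<in> carrier_mat n n" and "A * B = 1\<^sub>m n" and "B * A = 1\<^sub>m n" and "det B \<noteq> 0"
proof -
  have "A \<in> Units (ring_mat TYPE('a) n ())"
    using assms by (rule det_non_zero_imp_unit)
  then obtain B where B: "B \<in> carrier_mat n n" "A * B = 1\<^sub>m n" "B * A = 1\<^sub>m n"
    unfolding Units_def ring_mat_def by auto
  from B(3) have "det B * det A = 1"
    using det_mult[OF B(1) assms(1)] by simp
  then have "det B \<noteq> 0" by auto
  with B show ?thesis by (rule that)
qed

lemma carrier_GL_iff:
  "A \<in> carrier (GL TYPE('a::field) n) \<longleftrightarrow> A \<in> carrier_mat n n \<and> det A \<noteq> 0"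
proof -
  have "A \<in> Units (ring_mat TYPE('a) n ()) \<longleftrightarrow> A \<in> carrier_mat n n \<and> det A \<noteq> 0"
    using det_non_zero_imp_unit[of A n "()"] unit_imp_det_non_zero[of A n "()"]
    by (auto simp: Units_def ring_mat_def)
  then show ?thesis by (simp add: GL_def units_of_carrier)
qed

lemma matrix_right_cancel:
  fixes A B P :: "'a::field mat"
  assumes "A \<in> carrier_mat m n" "B \<in> carrier_mat m n" "P \<in> carrier_mat n n" "det P \<noteq> 0"
    and "A * P = B * P"
  shows "A = B"
proof -
  obtain Q where Q: "Q \<in> carrier_mat n n" "P * Q = 1\<^sub>m n"
    using matrix_inverse_exists[OF assms(3,4)] by metis
  have cancel: "C * P * Q = C" if "C \<in> carrier_mat m n" for C
    using assoc_mult_mat[OF that assms(3) Q(1)] Q(2) that by simp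
  have "A = A * P * Q" using cancel[OF assms(1)] by (rule sym)
  also have "\<dots> = B * P * Q" by (simp only: assms(5))
  also have "\<dots> = B" by (rule cancel[OF assms(2)])
  finally show ?thesis .
qed

section \<open>Congruence of alternating matrices\<close>

definition congruent_mat :: "nat \<Rightarrow> 'a::field mat \<Rightarrow> 'a mat \<Rightarrow> bool" where
  "congruent_mat n A B \<longleftrightarrow> A \<in> carrier_mat n n \<and>
    (\<exists>P \<in> carrier_mat n n. det P \<noteq> 0 \<and> B = P\<^sup>T * A * P)"

text \<open>
  The Gram matrices of nondegenerate alternating forms: in characteristic zero skew-symmetry already
  forces the diagonal to vanish.
\<close>

definition symplectic_gram :: "nat \<Rightarrow> 'a::field mat \<Rightarrow> bool" where
  "symplectic_gram n A \<longleftrightarrow> A \<in> carrier_mat n n \<and> A\<^sup>T = - A \<and> det A \<noteq> 0"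

lemma skew_entry:
  assumes "A \<in> carrier_mat n n" "A\<^sup>T = - A" "i < n" "j < n"
  shows "A $$ (i, j) = - (A $$ (j, i) :: 'a::field)"
proof -
  have "A\<^sup>T $$ (j, i) = (- A) $$ (j, i)" using assms(2) by simp
  then show ?thesis using assms(1,3,4) by simp
qed

lemma skew_matI:
  assumes "A \<in> carrier_mat n n" "\<And>i j. i < n \<Longrightarrow> j < n \<Longrightarrow> A $$ (i, j) = - (A $$ (j, i) :: 'a::field)"
  shows "A\<^sup>T = - A"
proof (rule eq_matI)
  fix i j assume "i < dim_row (- A)" "j < dim_col (- A)"
  then have ij: "i < n" "j < n" using assms(1) by auto
  show "A\<^sup>T $$ (i, j) = (- A) $$ (i, j)"
    using assms(2)[OF ij(2,1)] assms(1) ij by simp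
qed (use assms(1) in auto)

text \<open>
  A skew-symmetric matrix that is block triangular is block diagonal. After one hyperbolic plane has
  been cleared on one side, this spares the computation of the block on the other side.
\<close>

lemma skew_block_diagonal:
  fixes A :: "'a::field mat"
  assumes A: "A \<in> carrier_mat k k" and C: "C \<in> carrier_mat m k" and D: "D \<in> carrier_mat m m"
    and skew: "(four_block_mat A (0\<^sub>m k m) C D)\<^sup>T = - four_block_mat A (0\<^sub>m k m) C D"
  shows "C = 0\<^sub>m m k" and "D\<^sup>T = - D"
proof -
  let ?M = "four_block_mat A (0\<^sub>m k m) C D"
  have M: "?M \<in> carrier_mat (k + m) (k + m)" using A D by auto
  show "C = 0\<^sub>m m k"
  proof (rule eq_matI)
    fix i j assume "i < dim_row (0\<^sub>m m k :: 'a mat)" "j < dim_col (0\<^sub>m m k :: 'a mat)"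
    then have ij: "i < m" "j < k" by auto
    have "?M $$ (k + i, j) = - ?M $$ (j, k + i)"
      by (rule skew_entry[OF M skew]) (use ij in auto)
    then show "C $$ (i, j) = 0\<^sub>m m k $$ (i, j)" using ij A C D by simp
  qed (use C in auto)
  show "D\<^sup>T = - D"
  proof (rule skew_matI[OF D])
    fix i j assume ij: "i < m" "j < m"
    have "?M $$ (k + i, k + j) = - ?M $$ (k + j, k + i)"
      by (rule skew_entry[OF M skew]) (use ij in auto)
    then show "D $$ (i, j) = - D $$ (j, i)" using ij A C D by simp
  qed
qed

lemma (in field_hom) symplectic_map_iff:
  "symplectic_gram n (map_mat hom A) \<longleftrightarrow> symplectic_gram n A"
proof -
  have "(map_mat hom A)\<^sup>T = map_mat hom (A\<^sup>T)" by (rule map_mat_transpose)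
  moreover have "- map_mat hom A = map_mat hom (- A)"
    by (intro eq_matI) (auto simp: hom_uminus)
  ultimately have "(map_mat hom A)\<^sup>T = - map_mat hom A \<longleftrightarrow> A\<^sup>T = - A"
    using mat_hom_inj[of "A\<^sup>T" "- A"] by auto
  then show ?thesis by (simp add: symplectic_gram_def)
qed

lemma transpose_congruence:
  fixes A P :: "'a::field mat"
  assumes "A \<in> carrier_mat n n" "P \<in> carrier_mat n n"
  shows "(P\<^sup>T * A * P)\<^sup>T = P\<^sup>T * A\<^sup>T * P"
  using assms by (simp add: transpose_mult[of _ n n _ n] assoc_mult_mat[of _ n n _ n _ n])

lemma congruence_mult:
  fixes A P Q :: "'a::field mat"
  assumes "A \<in> carrier_mat n n" "P \<in> carrier_mat n n" "Q \<in> carrier_mat n n"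
  shows "(P * Q)\<^sup>T * A * (P * Q) = Q\<^sup>T * (P\<^sup>T * A * P) * Q"
proof -
  have "(P * Q)\<^sup>T * A * (P * Q) = Q\<^sup>T * P\<^sup>T * A * (P * Q)"
    using assms by (simp add: transpose_mult[of _ n n _ n])
  also have "\<dots> = Q\<^sup>T * (P\<^sup>T * A * P) * Q"
    using assms by (simp add: assoc_mult_mat[of _ n n _ n _ n] mult_carrier_mat[of _ n n _ n])
  finally show ?thesis .
qed

lemma symplectic_congruent:
  assumes "symplectic_gram n A" "congruent_mat n A B"
  shows "symplectic_gram n B"
proof -
  obtain P where P: "P \<in> carrier_mat n n" "det P \<noteq> 0" "B = P\<^sup>T * A * P"
    using assms(2) unfolding congruent_mat_def by auto
  have A: "A \<in> carrier_mat n n" "A\<^sup>T = - A" "det A \<noteq> 0"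
    using assms(1) unfolding symplectic_gram_def by auto
  have "B\<^sup>T = P\<^sup>T * (- A) * P" using transpose_congruence[OF A(1) P(1)] A(2) P(3) by simp
  also have "\<dots> = - B" using A(1) P by (simp add: uminus_mult_left_mat uminus_mult_right_mat)
  finally have "B\<^sup>T = - B" .
  moreover have "det B = det P * det A * det P"
    using A(1) P by (simp add: det_mult[of _ n] det_transpose[of _ n])
  ultimately show ?thesis using A P unfolding symplectic_gram_def by auto
qed

lemma congruent_refl: "A \<in> carrier_mat n n \<Longrightarrow> congruent_mat n A A"
  unfolding congruent_mat_def by (auto intro!: bexI[of _ "1\<^sub>m n"])

lemma congruent_trans:
  assumes "congruent_mat n A B" "congruent_mat n B C"
  shows "congruent_mat n A C"
proof -
  obtain P where P: "P \<in> carrier_mat n n" "det P \<noteq> 0" "B = P\<^sup>T * A * P" "A \<in> carrier_mat n n"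
    using assms(1) unfolding congruent_mat_def by auto
  obtain Q where Q: "Q \<in> carrier_mat n n" "det Q \<noteq> 0" "C = Q\<^sup>T * B * Q"
    using assms(2) unfolding congruent_mat_def by auto
  have "C = (P * Q)\<^sup>T * A * (P * Q)"
    using congruence_mult[OF P(4,1) Q(1)] P(3) Q(3) by simp
  moreover have "P * Q \<in> carrier_mat n n" "det (P * Q) \<noteq> 0"
    using P Q by (auto simp: det_mult[of _ n])
  ultimately show ?thesis using P(4) unfolding congruent_mat_def by blast
qed

lemma congruent_sym:
  assumes "congruent_mat n A B"
  shows "congruent_mat n B A"
proof -
  obtain P where P: "P \<in> carrier_mat n n" "det P \<noteq> 0" "B = P\<^sup>T * A * P" "A \<in> carrier_mat n n"
    using assms unfolding congruent_mat_def by auto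
  obtain Q where Q: "Q \<in> carrier_mat n n" "P * Q = 1\<^sub>m n" "det Q \<noteq> 0"
    using matrix_inverse_exists[OF P(1,2)] by metis
  have "A = Q\<^sup>T * B * Q"
    using congruence_mult[OF P(4,1) Q(1)] P Q by simp
  moreover have "B \<in> carrier_mat n n" using P by auto
  ultimately show ?thesis using Q unfolding congruent_mat_def by blast
qed

text \<open>
  The Gram matrix of the orthogonal sum of a hyperbolic plane and the form with Gram matrix \<open>A\<close>.
\<close>

definition hyperbolic_sum :: "nat \<Rightarrow> 'a::field mat \<Rightarrow> 'a mat" where
  "hyperbolic_sum m A = four_block_mat
    (mat 2 2 (\<lambda>(i, j). if i = j then 0 else if i < j then 1 else - 1)) (0\<^sub>m 2 m) (0\<^sub>m m 2) A"

lemma hyperbolic_sum_congruent: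
  fixes A B :: "'a::field mat"
  assumes "congruent_mat m A B"
  shows "congruent_mat (2 + m) (hyperbolic_sum m A) (hyperbolic_sum m B)"
proof -
  obtain P where P: "P \<in> carrier_mat m m" "det P \<noteq> 0" "B = P\<^sup>T * A * P" "A \<in> carrier_mat m m"
    using assms unfolding congruent_mat_def by auto
  define H :: "'a mat" where "H = mat 2 2 (\<lambda>(i, j). if i = j then 0 else if i < j then 1 else - 1)"
  have H: "H \<in> carrier_mat 2 2" by (simp add: H_def)
  let ?P = "four_block_mat (1\<^sub>m 2) (0\<^sub>m 2 m) (0\<^sub>m m 2) P"
  have "det ?P = det P"
    using P(1) by (subst det_four_block_mat_upper_right_zero[of _ 2 _ m]) auto
  moreover have "?P\<^sup>T * hyperbolic_sum m A * ?P = hyperbolic_sum m B"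
    unfolding hyperbolic_sum_def H_def[symmetric] using P(1,4) H
    by (simp add: transpose_four_block_mat[of _ 2 2 _ m _ m] P(3)
        mult_four_block_mat[of _ 2 2 _ m _ m _ _ 2 _ m])
  moreover have "hyperbolic_sum m A \<in> carrier_mat (2 + m) (2 + m)"
    unfolding hyperbolic_sum_def H_def[symmetric] using P(4) H by auto
  ultimately show ?thesis
    using P unfolding congruent_mat_def by (intro conjI bexI[of _ ?P]) auto
qed

text \<open>
  A nondegenerate form pairs the first basis vector nontrivially with some other basis vector, and
  exchanging that one with the second basis vector is a congruence.
\<close>

lemma congruent_pivot:
  fixes A :: "'a::field_char_0 mat"
  assumes "symplectic_gram n A" "0 < n"
  obtains B where "congruent_mat n A B" "2 \<le> n" "B $$ (0, 1) \<noteq> 0"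
proof -
  have A: "A \<in> carrier_mat n n" "A\<^sup>T = - A" "det A \<noteq> 0"
    using assms(1) unfolding symplectic_gram_def by auto
  have "\<exists>i<n. A $$ (0, i) \<noteq> 0"
  proof (rule ccontr)
    assume "\<not> (\<exists>i<n. A $$ (0, i) \<noteq> 0)"
    then have "row A 0 = 0\<^sub>v n" using A(1) assms(2) by (intro eq_vecI) auto
    obtain Q where Q: "Q \<in> carrier_mat n n" "A * Q = 1\<^sub>m n"
      using matrix_inverse_exists[OF A(1,3)] by metis
    have "(A * Q) $$ (0, 0) = row A 0 \<bullet> col Q 0" using A(1) Q(1) assms(2) by simp
    also have "\<dots> = 0" using \<open>row A 0 = 0\<^sub>v n\<close> Q(1) assms(2) by simp
    finally show False using Q(2) assms(2) by simp
  qed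
  then obtain i where i: "i < n" "A $$ (0, i) \<noteq> 0" by auto
  have "A $$ (0, 0) = 0" using skew_entry[OF A(1,2) assms(2) assms(2)] by simp
  then have i0: "i \<noteq> 0" using i by metis
  then have n: "2 \<le> n" using i by simp
  let ?P = "swaprows_mat n 1 i :: 'a mat"
  have PT: "?P\<^sup>T = ?P" by (intro eq_matI) auto
  have detP: "det ?P \<noteq> 0"
    using swaprows_mat_Unit[of 1 n i, THEN unit_imp_det_non_zero] i n by auto
  have PA: "?P * A = swaprows 1 i A" using swaprows_mat[OF A(1), of 1 i] i n by simp
  have "?P\<^sup>T * A * ?P = swapcols 1 i (swaprows 1 i A)"
    unfolding PT PA using swapcols_mat[of "swaprows 1 i A" n n 1 i] A i n by simp
  then have "(?P\<^sup>T * A * ?P) $$ (0, 1) = A $$ (0, i)" using A(1) i i0 n by simp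
  then have e: "(?P\<^sup>T * A * ?P) $$ (0, 1) \<noteq> 0" using i(2) by simp
  have c: "congruent_mat n A (?P\<^sup>T * A * ?P)"
    unfolding congruent_mat_def using A(1) detP by (intro conjI bexI[of _ ?P]) auto
  show ?thesis by (rule that[OF c n e])
qed

text \<open>
  The first two basis vectors span a nondegenerate plane. It becomes hyperbolic after rescaling one
  of them, and it splits off because every other basis vector can be corrected by its projection to
  the plane.
\<close>

lemma congruent_hyperbolic_sum:
  fixes A :: "'a::field_char_0 mat"
  assumes "symplectic_gram (2 + m) A" and pivot: "A $$ (0, 1) \<noteq> 0"
  obtains B where "congruent_mat (2 + m) A (hyperbolic_sum m B)" "symplectic_gram m B"
proof -
  have A: "A \<in> carrier_mat (2 + m) (2 + m)" "A\<^sup>T = - A" "det A \<noteq> 0"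
    using assms(1) unfolding symplectic_gram_def by auto
  note skew = skew_entry[OF A(1,2)]
  have diag: "A $$ (i, i) = 0" if "i < 2 + m" for i
    using skew[OF that that] by simp
  define c where "c = A $$ (0, 1)"
  have c: "c \<noteq> 0" using pivot by (simp add: c_def)
  have A10: "A $$ (1, 0) = - c" using skew[of 1 0] by (simp add: c_def)
  define H :: "'a mat" where "H = mat 2 2 (\<lambda>(i, j). if i = j then 0 else if i < j then 1 else - 1)"
  define R where "R = mat 2 m (\<lambda>(i, j). A $$ (i, j + 2))"
  define D where "D = mat m m (\<lambda>(i, j). A $$ (i + 2, j + 2))"
  define q where "q = mat 2 2 (\<lambda>(i, j). if i \<noteq> j then 0 else if i = 0 then 1 else 1 / c)"
  \<comment> \<open>Since \<open>H\<close> squares to \<open>- 1\<close>, this is \<open>- (c H)\<inverse> R\<close>: its columns are minus the projections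
    of the remaining basis vectors to the plane, so that they become orthogonal to it.\<close>
  define X where "X = (1 / c) \<cdot>\<^sub>m (H * R)"
  have carr: "H \<in> carrier_mat 2 2" "R \<in> carrier_mat 2 m" "D \<in> carrier_mat m m"
    "q \<in> carrier_mat 2 2" "X \<in> carrier_mat 2 m"
    by (simp_all add: H_def R_def D_def q_def X_def mult_carrier_mat[of _ 2 2])
  have less2: "i = 0 \<or> i = 1" if "i < 2" for i :: nat using that by auto
  have Ablock: "A = four_block_mat (c \<cdot>\<^sub>m H) R (- R\<^sup>T) D"
  proof (rule eq_matI)
    show "dim_row A = dim_row (four_block_mat (c \<cdot>\<^sub>m H) R (- R\<^sup>T) D)"
      "dim_col A = dim_col (four_block_mat (c \<cdot>\<^sub>m H) R (- R\<^sup>T) D)"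
      using A(1) carr by auto
    fix i j assume ij: "i < dim_row (four_block_mat (c \<cdot>\<^sub>m H) R (- R\<^sup>T) D)"
      "j < dim_col (four_block_mat (c \<cdot>\<^sub>m H) R (- R\<^sup>T) D)"
    then have ij': "i < 2 + m" "j < 2 + m" using carr by auto
    show "A $$ (i, j) = four_block_mat (c \<cdot>\<^sub>m H) R (- R\<^sup>T) D $$ (i, j)"
    proof (cases "i < 2 \<and> j < 2")
      case True
      then show ?thesis
        using less2[of i] less2[of j] carr A10 diag[of 0] diag[of 1]
        by (auto simp: H_def c_def)
    next
      case False
      have shift: "Suc (Suc (k - 2)) = k" if "\<not> k < 2" for k :: nat using that by simp
      from False show ?thesis using ij' carr skew[of i j]
        by (auto simp: H_def R_def D_def shift)
    qed
  qed
  let ?P = "four_block_mat q X (0\<^sub>m m 2) (1\<^sub>m m)"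
  have P: "?P \<in> carrier_mat (2 + m) (2 + m)" using carr by auto
  have "det q = 1 / c"
    using det_upper_triangular[OF _ carr(4)]
    by (simp add: q_def upper_triangular_def diag_mat_def numeral_2_eq_2)
  then have detP: "det ?P \<noteq> 0"
    using carr c by (subst det_four_block_mat_lower_left_zero[of _ 2 _ m]) auto
  have HH: "H * H = - 1\<^sub>m 2"
    by (intro eq_matI) (auto simp: H_def scalar_prod_def numeral_2_eq_2 less_Suc_eq)
  have smult_smult: "a \<cdot>\<^sub>m (b \<cdot>\<^sub>m M) = (a * b) \<cdot>\<^sub>m M"
    and one_smult: "1 \<cdot>\<^sub>m M = M" for a b and M :: "'a mat"
    by (intro eq_matI; auto)+
  have "(c \<cdot>\<^sub>m H) * X = H * (H * R)"
    using carr c unfolding X_def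
    by (simp add: mult_smult_assoc_mat[of _ 2 2 _ m] mult_smult_distrib[of _ 2 2 _ m]
        mult_carrier_mat[of _ 2 2 _ m] smult_smult one_smult)
  also have "\<dots> = (H * H) * R" using carr by simp
  also have "\<dots> = - R" using carr HH by simp
  finally have cancel: "(c \<cdot>\<^sub>m H) * X + R = 0\<^sub>m 2 m"
    using carr by (intro eq_matI) auto
  have qq: "q\<^sup>T * ((c \<cdot>\<^sub>m H) * q) = H"
    using c by (intro eq_matI)
      (auto simp: H_def q_def scalar_prod_def numeral_2_eq_2 less_Suc_eq)
  let ?C = "X\<^sup>T * ((c \<cdot>\<^sub>m H) * q) + (- R\<^sup>T) * q"
  let ?B = "(- R\<^sup>T) * X + D"
  have carr2: "?C \<in> carrier_mat m 2" "?B \<in> carrier_mat m m" using carr by auto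
  define U V W where "U = (c \<cdot>\<^sub>m H) * q" and "V = (- R\<^sup>T) * q" and "W = ?B"
  have UVW: "U \<in> carrier_mat 2 2" "V \<in> carrier_mat m 2" "W \<in> carrier_mat m m"
    using carr by (auto simp: U_def V_def W_def)
  have AP: "A * ?P = four_block_mat U (0\<^sub>m 2 m) V W"
    unfolding Ablock cancel[symmetric] U_def V_def W_def using carr
    by (subst mult_four_block_mat[of _ 2 2 _ m _ m _ _ 2 _ m]) auto
  have "?P\<^sup>T = four_block_mat q\<^sup>T (0\<^sub>m 2 m) X\<^sup>T (1\<^sub>m m)"
    using carr by (simp add: transpose_four_block_mat[of _ 2 2 _ m _ m])
  then have "?P\<^sup>T * (A * ?P) = four_block_mat
      (q\<^sup>T * U + 0\<^sub>m 2 m * V) (q\<^sup>T * 0\<^sub>m 2 m + 0\<^sub>m 2 m * W)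
      (X\<^sup>T * U + 1\<^sub>m m * V) (X\<^sup>T * 0\<^sub>m 2 m + 1\<^sub>m m * W)"
    unfolding AP using mult_four_block_mat[of "q\<^sup>T" 2 2 "0\<^sub>m 2 m" m "X\<^sup>T" m "1\<^sub>m m" U 2 "0\<^sub>m 2 m" m V W]
      carr UVW by simp
  also have "\<dots> = four_block_mat (q\<^sup>T * U) (0\<^sub>m 2 m) (X\<^sup>T * U + V) W"
    using carr UVW by simp
  finally have "?P\<^sup>T * (A * ?P) = four_block_mat H (0\<^sub>m 2 m) ?C ?B"
    by (simp only: qq U_def V_def W_def)
  then have blk: "?P\<^sup>T * A * ?P = four_block_mat H (0\<^sub>m 2 m) ?C ?B"
    using P A(1) by (simp add: assoc_mult_mat[of _ "2 + m" "2 + m" _ "2 + m" _ "2 + m"])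
  have cong: "congruent_mat (2 + m) A (four_block_mat H (0\<^sub>m 2 m) ?C ?B)"
    unfolding congruent_mat_def blk[symmetric] using A(1) P detP by blast
  then have sym: "symplectic_gram (2 + m) (four_block_mat H (0\<^sub>m 2 m) ?C ?B)"
    using symplectic_congruent[OF assms(1)] by blast
  let ?M = "four_block_mat H (0\<^sub>m 2 m) ?C ?B"
  have M: "?M \<in> carrier_mat (2 + m) (2 + m)" "?M\<^sup>T = - ?M" "det ?M \<noteq> 0"
    using sym unfolding symplectic_gram_def by auto
  have C0: "?C = 0\<^sub>m m 2" and "?B\<^sup>T = - ?B"
    using skew_block_diagonal[OF carr(1) carr2 M(2)] by blast+
  have "det ?M = det H * det ?B"
    using carr carr2 by (intro det_four_block_mat_upper_right_zero) auto
  then have "det ?B \<noteq> 0" using M(3) by auto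
  with \<open>?B\<^sup>T = - ?B\<close> have "symplectic_gram m ?B" using carr2 unfolding symplectic_gram_def by blast
  moreover have "congruent_mat (2 + m) A (hyperbolic_sum m ?B)"
    using cong[unfolded C0] unfolding hyperbolic_sum_def H_def .
  ultimately show ?thesis by (intro that)
qed

text \<open>
  Splitting off hyperbolic planes one at a time brings both forms to the same normal form. In
  dimension one the determinant vanishes, so that a plane can be split off whenever the dimension is
  positive.
\<close>

lemma symplectic_grams_congruent:
  fixes A B :: "'a::field_char_0 mat"
  assumes "symplectic_gram n A" "symplectic_gram n B"
  shows "congruent_mat n A B"
  using assms
proof (induction n arbitrary: A B rule: less_induct)
  case (less n)
  show ?case
  proof (cases "n = 0")
    case True
    then have "A = B" using less.prems by (intro eq_matI) (auto simp: symplectic_gram_def)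
    then show ?thesis using less.prems congruent_refl by (auto simp: symplectic_gram_def)
  next
    case False
    then have "2 \<le> n" using congruent_pivot[OF less.prems(1)] by blast
    then obtain m where n: "n = 2 + m" by (metis le_iff_add)
    have split: "\<exists>C'. congruent_mat n C (hyperbolic_sum m C') \<and> symplectic_gram m C'"
      if C: "symplectic_gram n C" for C :: "'a mat"
    proof -
      obtain C1 where C1: "congruent_mat n C C1" "C1 $$ (0, 1) \<noteq> 0"
        using congruent_pivot[OF C] False by blast
      obtain C' where "congruent_mat n C1 (hyperbolic_sum m C')" "symplectic_gram m C'"
        using congruent_hyperbolic_sum[OF symplectic_congruent[OF C C1(1), unfolded n] C1(2)]
        unfolding n by blast
      then show ?thesis using congruent_trans[OF C1(1)] by blast
    qed
    obtain A' where A': "congruent_mat n A (hyperbolic_sum m A')" "symplectic_gram m A'"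
      using split[OF less.prems(1)] by blast
    obtain B' where B': "congruent_mat n B (hyperbolic_sum m B')" "symplectic_gram m B'"
      using split[OF less.prems(2)] by blast
    have "congruent_mat m A' B'" by (rule less.IH[OF _ A'(2) B'(2)]) (simp add: n)
    from hyperbolic_sum_congruent[OF this]
    have "congruent_mat n (hyperbolic_sum m A') (hyperbolic_sum m B')" by (simp only: n)
    then show ?thesis using A'(1) B'(1) congruent_trans congruent_sym by blast
  qed
qed

section \<open>Hilbert 90 for the general linear group\<close>

text \<open>
  For every scalar \<open>c\<close> the average \<open>h = c + \<sigma>(c) x\<close> satisfies \<open>x \<sigma>(h) = h\<close>. It is singular only if
  \<open>- c / \<sigma>(c)\<close> is an eigenvalue of \<open>x\<close>. There are finitely many eigenvalues, while the scalars
  \<open>c = \<alpha> + t\<close> for natural numbers \<open>t\<close> give infinitely many such quotients.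
\<close>

lemma hilbert_90_matrix:
  fixes \<sigma> :: "'e::field_char_0 \<Rightarrow> 'e"
  assumes "field_hom \<sigma>" and moved: "\<sigma> \<alpha> \<noteq> \<alpha>" and invol: "\<sigma> (\<sigma> \<alpha>) = \<alpha>"
    and x: "x \<in> carrier_mat n n" "x * map_mat \<sigma> x = 1\<^sub>m n"
  obtains h where "h \<in> carrier_mat n n" "det h \<noteq> 0" "x * map_mat \<sigma> h = h"
proof -
  interpret field_hom \<sigma> by fact
  define p where "p = char_poly x"
  have "p \<noteq> 0" using degree_monic_char_poly[OF x(1)] by (auto simp: p_def)
  then have fin: "finite {k. poly p k = 0}" by (rule poly_roots_finite)
  have nz: "\<sigma> \<alpha> + of_nat t \<noteq> 0" for t
  proof
    assume *: "\<sigma> \<alpha> + of_nat t = 0"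
    then have "\<sigma> (\<sigma> \<alpha> + of_nat t) = 0" by simp
    then have "\<alpha> + of_nat t = 0" using invol by (simp add: hom_add hom_of_nat)
    with * moved show False by (metis add_right_cancel)
  qed
  let ?r = "\<lambda>t::nat. - ((\<alpha> + of_nat t) / (\<sigma> \<alpha> + of_nat t))"
  \<comment> \<open>\<open>?r\<close> is a fractional linear function of \<open>t\<close> with determinant \<open>\<alpha> - \<sigma> \<alpha>\<close> up to sign.\<close>
  have "inj ?r"
  proof (rule injI)
    fix s t assume "?r s = ?r t"
    then have "(\<alpha> + of_nat s) * (\<sigma> \<alpha> + of_nat t) = (\<alpha> + of_nat t) * (\<sigma> \<alpha> + of_nat s)"
      using nz by (simp add: frac_eq_eq)
    then have "(\<alpha> - \<sigma> \<alpha>) * (of_nat t - of_nat s) = 0" by (simp add: algebra_simps)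
    then show "s = t" using moved by simp
  qed
  then have "infinite (range ?r)" by (simp add: finite_image_iff)
  then have "\<exists>t. poly p (?r t) \<noteq> 0"
    using fin finite_subset[of "range ?r" "{k. poly p k = 0}"] by blast
  then obtain t where t: "poly p (?r t) \<noteq> 0" by blast
  define c where "c = \<alpha> + of_nat t"
  define d where "d = \<sigma> \<alpha> + of_nat t"
  have cd: "\<sigma> c = d" "\<sigma> d = c" "d \<noteq> 0"
    using invol nz by (simp_all add: c_def d_def hom_add hom_of_nat)
  let ?h = "c \<cdot>\<^sub>m 1\<^sub>m n + d \<cdot>\<^sub>m x"
  have "\<not> eigenvalue x (- (c / d))"
    using t eigenvalue_root_char_poly[OF x(1)] by (simp add: p_def c_def d_def)
  then have "det (char_matrix x (- (c / d))) \<noteq> 0" using eigenvalue_det[OF x(1)] by simp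
  moreover have "?h = d \<cdot>\<^sub>m char_matrix x (- (c / d))"
    using x(1) cd(3) by (intro eq_matI) (auto simp: char_matrix_def field_simps)
  ultimately have "det ?h \<noteq> 0" using cd(3) by (simp add: det_smult)
  moreover have "?h \<in> carrier_mat n n" using x by auto
  moreover have "x * map_mat \<sigma> ?h = ?h"
  proof -
    have "map_mat \<sigma> ?h = d \<cdot>\<^sub>m 1\<^sub>m n + c \<cdot>\<^sub>m map_mat \<sigma> x"
      using x(1) cd by (intro eq_matI) (auto simp: hom_add hom_mult)
    then have "x * map_mat \<sigma> ?h = d \<cdot>\<^sub>m x + c \<cdot>\<^sub>m (x * map_mat \<sigma> x)"
      using x(1) by (simp add: mult_add_distrib_mat[of _ n n _ n] mult_smult_distrib[of _ n n _ n])
    also have "\<dots> = ?h" using x by (simp add: comm_add_mat[of _ n n])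
    finally show ?thesis .
  qed
  ultimately show ?thesis by (intro that)
qed

section \<open>The quadratic extension\<close>

context quadratic_local_field_extension
begin

lemma field_generated:
  assumes "\<sigma> \<alpha> \<noteq> \<alpha>"
  shows "\<exists>a b. x = \<iota> a + \<iota> b * \<alpha>"
proof -
  interpret vs: vector_space "\<lambda>a x. \<iota> a * x"
    by unfold_locales (auto simp: algebra_simps emb.hom_add emb.hom_mult)
  have sp1: "vs.span {1} = range \<iota>" by (simp add: vs.span_singleton)
  have "\<alpha> \<notin> range \<iota>" using assms gal_fixes by auto
  then have ind: "vs.independent {\<alpha>, 1}"
    by (simp add: vs.independent_insert sp1)
  obtain B where B: "{\<alpha>, 1} \<subseteq> B" "vs.independent B" "UNIV \<subseteq> vs.span B"
    by (rule vs.maximal_independent_subset_extend[OF subset_UNIV ind])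
  have "vs.span B = vs.span UNIV" using B(3) vs.span_UNIV by blast
  then have cB: "card B = 2" using vs.dim_eq_card[of B UNIV] B(2) quadratic by simp
  then have "finite B" by (intro card_ge_0_finite) simp
  moreover have "card {\<alpha>, 1} = 2" using assms by (cases "\<alpha> = 1") simp_all
  ultimately have "{\<alpha>, 1} = B" using B(1) cB by (intro card_subset_eq) simp_all
  then have "x \<in> vs.span {\<alpha>, 1}" using B(3) by blast
  then obtain b where "x - \<iota> b * \<alpha> \<in> vs.span {1}" unfolding vs.span_insert by blast
  then obtain a where "x - \<iota> b * \<alpha> = \<iota> a" unfolding sp1 by blast
  then show ?thesis by (metis diff_add_cancel)
qed

lemma fixed_imp_base:
  assumes "\<sigma> x = x"
  shows "x \<in> range \<iota>"
proof -
  obtain \<alpha> where \<alpha>: "\<sigma> \<alpha> \<noteq> \<alpha>" using gal_nontrivial by (auto simp: fun_eq_iff)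
  obtain a b where x: "x = \<iota> a + \<iota> b * \<alpha>" using field_generated[OF \<alpha>] by blast
  have "\<iota> b * (\<sigma> \<alpha> - \<alpha>) = 0"
    using assms unfolding x by (simp add: gal.hom_add gal.hom_mult gal_fixes algebra_simps)
  then have "\<iota> b = 0" using \<alpha> by simp
  then show ?thesis using x by simp
qed

text \<open>
  A moved element \<open>\<alpha>\<close> is a root of a monic quadratic polynomial over the small field, and so is its
  conjugate. The two are distinct, hence their sum is the trace, which lies in the small field, and
  \<open>\<sigma>\<close> exchanges them.
\<close>

lemma galois_involution: "\<sigma> (\<sigma> x) = x"
proof -
  obtain \<alpha> where \<alpha>: "\<sigma> \<alpha> \<noteq> \<alpha>" using gal_nontrivial by (auto simp: fun_eq_iff)
  obtain a b where sq: "\<alpha> * \<alpha> = \<iota> a + \<iota> b * \<alpha>" using field_generated[OF \<alpha>] by blast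
  have "\<sigma> \<alpha> * \<sigma> \<alpha> = \<iota> a + \<iota> b * \<sigma> \<alpha>"
    using arg_cong[OF sq, of \<sigma>] by (simp add: gal.hom_add gal.hom_mult gal_fixes)
  then have "(\<sigma> \<alpha> - \<alpha>) * (\<sigma> \<alpha> + \<alpha> - \<iota> b) = 0" using sq by (simp add: algebra_simps)
  then have "\<sigma> \<alpha> + \<alpha> - \<iota> b = 0" using \<alpha> by simp
  then have "\<sigma> \<alpha> = \<iota> b - \<alpha>" by (simp add: eq_diff_eq)
  then have "\<sigma> (\<sigma> \<alpha>) = \<alpha>" using gal_fixes by (simp add: gal.hom_minus)
  moreover obtain c d where "x = \<iota> c + \<iota> d * \<alpha>" using field_generated[OF \<alpha>] by blast
  ultimately show ?thesis by (simp add: gal.hom_add gal.hom_mult gal_fixes)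
qed

lemma galois_mat_involution: "map_mat \<sigma> (map_mat \<sigma> A) = A"
  by (intro eq_matI) (auto simp: galois_involution)

lemma galois_mat_fixes: "map_mat \<sigma> (map_mat \<iota> A) = map_mat \<iota> A"
  by (intro eq_matI) (auto simp: gal_fixes)

lemma fixed_mat_imp_base:
  assumes "A \<in> carrier_mat m n" "map_mat \<sigma> A = A"
  obtains A' where "A' \<in> carrier_mat m n" "A = map_mat \<iota> A'"
proof -
  define A' where "A' = map_mat (inv_into UNIV \<iota>) A"
  have "\<iota> (inv_into UNIV \<iota> (A $$ (i, j))) = A $$ (i, j)" if ij: "i < m" "j < n" for i j
  proof -
    have "\<sigma> (A $$ (i, j)) = map_mat \<sigma> A $$ (i, j)" using assms(1) ij by simp
    then have "\<sigma> (A $$ (i, j)) = A $$ (i, j)" using assms(2) by simp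
    from f_inv_into_f[OF fixed_imp_base[OF this]] show ?thesis .
  qed
  then have "A = map_mat \<iota> A'" using assms(1) by (intro eq_matI) (auto simp: A'_def)
  then show ?thesis using assms(1) by (intro that[of A']) (auto simp: A'_def)
qed

text \<open>
  Hilbert 90 gives \<open>h\<close>, which transports \<open>J\<close> to a form defined over the small field; uniqueness of
  symplectic forms there yields the correction of \<open>h\<close> to an element of the form group.
\<close>

lemma cocycle_is_coboundary:
  assumes j: "symplectic_gram n j"
    and x: "x \<in> form_space \<sigma> n (map_mat \<iota> j)"
  obtains g where "g \<in> carrier (form_group n (map_mat \<iota> j))" "x * map_mat \<sigma> g = g"
proof -
  let ?J = "map_mat \<iota> j"
  have J: "?J \<in> carrier_mat n n" using j by (simp add: symplectic_gram_def)
  have \<sigma>J: "map_mat \<sigma> ?J = ?J" by (rule galois_mat_fixes)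
  have x': "x \<in> carrier_mat n n" "x\<^sup>T * ?J * x = ?J" "x * map_mat \<sigma> x = 1\<^sub>m n"
    using x unfolding form_space_def form_group_def by (auto simp: carrier_GL_iff)
  obtain \<alpha> where "\<sigma> \<alpha> \<noteq> \<alpha>" using gal_nontrivial by (auto simp: fun_eq_iff)
  then obtain h where h: "h \<in> carrier_mat n n" "det h \<noteq> 0" "x * map_mat \<sigma> h = h"
    using hilbert_90_matrix[OF gal.field_hom_axioms _ galois_involution x'(1,3)] by metis
  let ?K = "h\<^sup>T * ?J * h"
  have \<sigma>h: "map_mat \<sigma> h \<in> carrier_mat n n" using h by simp
  have K: "?K \<in> carrier_mat n n" using h J by auto
  \<comment> \<open>The transported form is Galois invariant because \<open>x\<close> preserves \<open>J\<close>.\<close>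
  have "map_mat \<sigma> ?K = (map_mat \<sigma> h)\<^sup>T * ?J * map_mat \<sigma> h"
    using h(1) J \<sigma>J
    by (simp add: gal.mat_hom_mult[of _ n n _ n] map_mat_transpose mult_carrier_mat[of _ n n])
  also have "\<dots> = (map_mat \<sigma> h)\<^sup>T * (x\<^sup>T * ?J * x) * map_mat \<sigma> h" using x'(2) by simp
  also have "\<dots> = ?K" using congruence_mult[OF J x'(1) \<sigma>h] h(3) by simp
  finally obtain k where k: "k \<in> carrier_mat n n" "?K = map_mat \<iota> k"
    using fixed_mat_imp_base[OF K] by blast
  have "symplectic_gram n ?J" using emb.symplectic_map_iff j by blast
  moreover have "congruent_mat n ?J ?K" unfolding congruent_mat_def using J h by blast
  ultimately have "symplectic_gram n ?K" by (rule symplectic_congruent)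
  then have "symplectic_gram n (map_mat \<iota> k)" by (simp add: k)
  then have "symplectic_gram n k" by (simp only: emb.symplectic_map_iff)
  then obtain p where p: "p \<in> carrier_mat n n" "det p \<noteq> 0" "j = p\<^sup>T * k * p"
    using symplectic_grams_congruent[OF _ j] unfolding congruent_mat_def by blast
  let ?p = "map_mat \<iota> p"
  have p': "?p \<in> carrier_mat n n" "det ?p \<noteq> 0" using p by auto
  have \<sigma>p: "map_mat \<sigma> ?p = ?p" by (rule galois_mat_fixes)
  have pJ: "?J = ?p\<^sup>T * ?K * ?p"
    unfolding k(2) using p(1) k(1)
    by (subst p(3)) (simp add: emb.mat_hom_mult[of _ n n _ n] map_mat_transpose mult_carrier_mat[of _ n n])
  have "(h * ?p)\<^sup>T * ?J * (h * ?p) = ?J"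
    using congruence_mult[OF J h(1) p'(1)] pJ by simp
  moreover have "h * ?p \<in> carrier (GL TYPE('e) n)"
    using h p' by (auto simp: carrier_GL_iff det_mult[of _ n])
  ultimately have "h * ?p \<in> carrier (form_group n ?J)" by (simp add: form_group_def)
  moreover have "x * map_mat \<sigma> (h * ?p) = h * ?p"
  proof -
    have "x * map_mat \<sigma> (h * ?p) = x * (map_mat \<sigma> h * ?p)"
      using h(1) p'(1) \<sigma>p by (simp add: gal.mat_hom_mult[of _ n n _ n])
    also have "\<dots> = x * map_mat \<sigma> h * ?p"
      using x'(1) \<sigma>h p'(1) by (simp add: assoc_mult_mat[of _ n n _ n _ n])
    finally show ?thesis using h(3) by simp
  qed
  ultimately show ?thesis by (rule that)
qed

end

section \<open>The twisted conjugation action\<close>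

lemma group_GL: "group (GL TYPE('a::field) n)"
proof -
  interpret R: ring "ring_mat TYPE('a) n ()" by (rule ring_mat)
  show ?thesis unfolding GL_def by (rule R.units_group)
qed

lemma mult_GL: "x \<otimes>\<^bsub>GL TYPE('a::field) n\<^esub> y = x * y"
  and one_GL: "\<one>\<^bsub>GL TYPE('a) n\<^esub> = 1\<^sub>m n"
  by (simp_all add: GL_def units_of_def ring_mat_def)

text \<open>
  This trades the inverse in the group for an equation between matrix products.
\<close>

lemma twisted_conj_eq_iff:
  fixes \<sigma> :: "'e::field \<Rightarrow> 'e"
  assumes "field_hom \<sigma>" "g \<in> carrier (GL TYPE('e) n)" "x \<in> carrier_mat n n" "y \<in> carrier_mat n n"
  shows "twisted_conj \<sigma> n g x = y \<longleftrightarrow> g * x = y * map_mat \<sigma> g"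
proof -
  interpret field_hom \<sigma> by fact
  interpret G: group "GL TYPE('e) n" by (rule group_GL)
  let ?s = "map_mat \<sigma> g"
  let ?i = "inv\<^bsub>GL TYPE('e) n\<^esub> ?s"
  have g: "g \<in> carrier_mat n n" "det g \<noteq> 0" using assms(2) by (auto simp: carrier_GL_iff)
  then have s: "?s \<in> carrier (GL TYPE('e) n)" by (simp add: carrier_GL_iff)
  then have s': "?s \<in> carrier_mat n n" by (simp add: carrier_GL_iff)
  have i: "?i \<in> carrier_mat n n" using G.inv_closed[OF s] by (simp add: carrier_GL_iff)
  have inverse: "?i * ?s = 1\<^sub>m n" "?s * ?i = 1\<^sub>m n"
    using G.l_inv[OF s] G.r_inv[OF s] by (simp_all add: mult_GL one_GL)
  have gx: "g * x \<in> carrier_mat n n" using g assms by simp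
  show ?thesis unfolding twisted_conj_def
  proof
    assume "g * x * ?i = y"
    then have "y * ?s = g * x * (?i * ?s)"
      using assoc_mult_mat[OF gx i s'] by simp
    then show "g * x = y * ?s" using inverse right_mult_one_mat[OF gx] by simp
  next
    assume "g * x = y * ?s"
    then have "g * x * ?i = y * (?s * ?i)"
      using assoc_mult_mat[OF assms(4) s' i] by simp
    then show "g * x * ?i = y" using inverse assms(4) by simp
  qed
qed

lemma twisted_conj_carrier:
  fixes \<sigma> :: "'e::field \<Rightarrow> 'e"
  assumes "field_hom \<sigma>" "g \<in> carrier (GL TYPE('e) n)" "x \<in> carrier_mat n n"
  shows "twisted_conj \<sigma> n g x \<in> carrier_mat n n"
proof -
  interpret field_hom \<sigma> by fact
  interpret G: group "GL TYPE('e) n" by (rule group_GL)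
  have "map_mat \<sigma> g \<in> carrier (GL TYPE('e) n)" using assms(2) by (simp add: carrier_GL_iff)
  then have "inv\<^bsub>GL TYPE('e) n\<^esub> (map_mat \<sigma> g) \<in> carrier_mat n n"
    using G.inv_closed by (simp add: carrier_GL_iff)
  then show ?thesis using assms(2,3) by (auto simp: twisted_conj_def carrier_GL_iff)
qed

lemma carrier_form_group_iff:
  "g \<in> carrier (form_group n J) \<longleftrightarrow> g \<in> carrier_mat n n \<and> det g \<noteq> 0 \<and> g\<^sup>T * J * g = J"
  by (auto simp: form_group_def carrier_GL_iff)

lemma form_group_mult:
  assumes "J \<in> carrier_mat n n" "g \<in> carrier (form_group n J)" "h \<in> carrier (form_group n J)"
  shows "g * h \<in> carrier (form_group n J)"
proof -
  have gh: "g \<in> carrier_mat n n" "h \<in> carrier_mat n n"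
    using assms(2,3) by (simp_all add: carrier_form_group_iff)
  show ?thesis
    using assms(2,3) gh congruence_mult[OF assms(1) gh]
    by (simp add: carrier_form_group_iff det_mult[OF gh])
qed

lemma form_group_divide:
  fixes J :: "'a::field mat"
  assumes J: "J \<in> carrier_mat n n"
    and y: "y \<in> carrier_mat n n" and g: "g \<in> carrier (form_group n J)"
    and yg: "y * g \<in> carrier (form_group n J)"
  shows "y \<in> carrier (form_group n J)"
proof -
  have g': "g \<in> carrier_mat n n" "g\<^sup>T * J * g = J" "det g \<noteq> 0"
    using g by (auto simp: carrier_form_group_iff)
  obtain q where q: "q \<in> carrier_mat n n" "g * q = 1\<^sub>m n" "det q \<noteq> 0"
    using matrix_inverse_exists[OF g'(1,3)] by metis
  have "q\<^sup>T * J * q = (g * q)\<^sup>T * J * (g * q)"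
    using congruence_mult[OF J g'(1) q(1)] g'(2) by simp
  then have "q \<in> carrier (form_group n J)" using q J by (simp add: carrier_form_group_iff)
  then have "(y * g) * q \<in> carrier (form_group n J)" using form_group_mult[OF J yg] by simp
  moreover have "(y * g) * q = y"
    using y g' q by (simp add: assoc_mult_mat[of _ n n _ n _ n])
  ultimately show ?thesis by simp
qed

context quadratic_local_field_extension
begin

lemma form_group_galois:
  assumes "j \<in> carrier_mat n n" "g \<in> carrier (form_group n (map_mat \<iota> j))"
  shows "map_mat \<sigma> g \<in> carrier (form_group n (map_mat \<iota> j))"
proof -
  have g: "g \<in> carrier_mat n n" "det g \<noteq> 0" "g\<^sup>T * map_mat \<iota> j * g = map_mat \<iota> j"
    using assms(2) by (auto simp: carrier_form_group_iff)
  have "(map_mat \<sigma> g)\<^sup>T * map_mat \<iota> j * map_mat \<sigma> g = map_mat \<sigma> (g\<^sup>T * map_mat \<iota> j * g)"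
    using g(1) assms(1)
    by (simp add: gal.mat_hom_mult[of _ n n _ n] map_mat_transpose mult_carrier_mat[of _ n n]
        galois_mat_fixes)
  then show ?thesis using g by (simp add: carrier_form_group_iff galois_mat_fixes)
qed

lemma twisted_conj_form_space:
  assumes j: "j \<in> carrier_mat n n" and g: "g \<in> carrier (form_group n (map_mat \<iota> j))"
    and x: "x \<in> form_space \<sigma> n (map_mat \<iota> j)"
  shows "twisted_conj \<sigma> n g x \<in> form_space \<sigma> n (map_mat \<iota> j)"
proof -
  let ?J = "map_mat \<iota> j" and ?y = "twisted_conj \<sigma> n g x"
  have J: "?J \<in> carrier_mat n n" using j by simp
  have gG: "g \<in> carrier (GL TYPE('e) n)" and g': "g \<in> carrier_mat n n" "det g \<noteq> 0"
    using g by (auto simp: carrier_form_group_iff carrier_GL_iff)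
  have x': "x \<in> carrier (form_group n ?J)" "x \<in> carrier_mat n n" "x * map_mat \<sigma> x = 1\<^sub>m n"
    using x by (auto simp: form_space_def carrier_form_group_iff)
  have y: "?y \<in> carrier_mat n n" by (rule twisted_conj_carrier[OF gal.field_hom_axioms gG x'(2)])
  have eq: "?y * map_mat \<sigma> g = g * x"
    using twisted_conj_eq_iff[OF gal.field_hom_axioms gG x'(2) y] by simp
  have "?y \<in> carrier (form_group n ?J)"
    using form_group_divide[OF J y form_group_galois[OF j g]] form_group_mult[OF J g x'(1)] eq
    by simp
  moreover have "?y * map_mat \<sigma> ?y = 1\<^sub>m n"
  proof (rule matrix_right_cancel[where m = n, OF _ _ g'])
    have "map_mat \<sigma> ?y * g = map_mat \<sigma> (?y * map_mat \<sigma> g)"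
      using y g' by (simp add: gal.mat_hom_mult[of _ n n _ n] galois_mat_involution)
    also have "\<dots> = map_mat \<sigma> g * map_mat \<sigma> x"
      unfolding eq using g' x' by (simp add: gal.mat_hom_mult[of _ n n _ n])
    finally have "?y * map_mat \<sigma> ?y * g = ?y * (map_mat \<sigma> g * map_mat \<sigma> x)"
      using y g' by (simp add: assoc_mult_mat[of _ n n _ n _ n])
    also have "\<dots> = (?y * map_mat \<sigma> g) * map_mat \<sigma> x"
      using y g' x' by (simp add: assoc_mult_mat[of _ n n _ n _ n])
    also have "\<dots> = g" unfolding eq using g' x' by (simp add: assoc_mult_mat[of _ n n _ n _ n])
    finally show "?y * map_mat \<sigma> ?y * g = 1\<^sub>m n * g" using g' by simp
  qed (use y in auto)
  ultimately show ?thesis by (simp add: form_space_def)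
qed

text \<open>
  Write \<open>x = g \<sigma>(g)\<inverse>\<close> and \<open>y = h \<sigma>(h)\<inverse>\<close> with \<open>g\<close> and \<open>h\<close> in the form group; then \<open>h g\<inverse>\<close> moves \<open>x\<close>
  to \<open>y\<close>.
\<close>

lemma form_space_transitive:
  assumes j: "symplectic_gram n j"
    and x: "x \<in> form_space \<sigma> n (map_mat \<iota> j)" and y: "y \<in> form_space \<sigma> n (map_mat \<iota> j)"
  obtains k where "k \<in> carrier (form_group n (map_mat \<iota> j))" "twisted_conj \<sigma> n k x = y"
proof -
  let ?J = "map_mat \<iota> j"
  have J: "?J \<in> carrier_mat n n" using j by (simp add: symplectic_gram_def)
  have xy: "x \<in> carrier_mat n n" "y \<in> carrier_mat n n"
    using x y by (auto simp: form_space_def carrier_form_group_iff)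
  obtain g where g: "g \<in> carrier (form_group n ?J)" "x * map_mat \<sigma> g = g"
    using cocycle_is_coboundary[OF j x] by blast
  obtain h where h: "h \<in> carrier (form_group n ?J)" "y * map_mat \<sigma> h = h"
    using cocycle_is_coboundary[OF j y] by blast
  have g': "g \<in> carrier_mat n n" "det g \<noteq> 0" and h': "h \<in> carrier_mat n n"
    using g h by (auto simp: carrier_form_group_iff)
  obtain q where q: "q \<in> carrier_mat n n" "q * g = 1\<^sub>m n"
    using matrix_inverse_exists[OF g'] by metis
  define k where "k = h * q"
  have k: "k \<in> carrier_mat n n" "k * g = h"
    using h' q g' by (simp_all add: k_def assoc_mult_mat[of _ n n _ n _ n])
  then have kS: "k \<in> carrier (form_group n ?J)" using form_group_divide[OF J k(1) g(1)] h(1) by simp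
  have "k * x = y * map_mat \<sigma> k"
  proof (rule matrix_right_cancel[where m = n and n = n and P = "map_mat \<sigma> g"])
    have "k * x * map_mat \<sigma> g = h"
      using k xy g' g(2) by (simp add: assoc_mult_mat[of _ n n _ n _ n])
    also have "\<dots> = y * map_mat \<sigma> (k * g)" using h(2) k(2) by simp
    also have "\<dots> = y * map_mat \<sigma> k * map_mat \<sigma> g"
      using k(1) g' xy by (simp add: gal.mat_hom_mult[of _ n n _ n] assoc_mult_mat[of _ n n _ n _ n])
    finally show "k * x * map_mat \<sigma> g = y * map_mat \<sigma> k * map_mat \<sigma> g" .
  qed (use k xy g' in auto)
  moreover have "k \<in> carrier (GL TYPE('e) n)" using kS by (simp add: form_group_def)
  ultimately have "twisted_conj \<sigma> n k x = y"
    using twisted_conj_eq_iff[OF gal.field_hom_axioms _ xy] by simp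
  with kS show ?thesis by (rule that)
qed

lemma orbit_eq_form_space:
  assumes j: "symplectic_gram n j" and x: "x \<in> form_space \<sigma> n (map_mat \<iota> j)"
  shows "orbit (form_group n (map_mat \<iota> j)) (twisted_conj \<sigma> n) x = form_space \<sigma> n (map_mat \<iota> j)"
proof
  have "j \<in> carrier_mat n n" using j by (simp add: symplectic_gram_def)
  then show "orbit (form_group n (map_mat \<iota> j)) (twisted_conj \<sigma> n) x \<subseteq> form_space \<sigma> n (map_mat \<iota> j)"
    using twisted_conj_form_space x by (auto simp: orbit_def)
  show "form_space \<sigma> n (map_mat \<iota> j) \<subseteq> orbit (form_group n (map_mat \<iota> j)) (twisted_conj \<sigma> n) x"
    using form_space_transitive[OF j x] by (force simp: orbit_def)
qed

end

theorem corollary3: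
  fixes v :: "'f::field_char_0 \<Rightarrow> real"
    and w :: "'e::field_char_0 \<Rightarrow> real"
    and \<iota> :: "'f \<Rightarrow> 'e"
    and \<sigma> :: "'e \<Rightarrow> 'e"
    and n :: nat
    and j :: "'f mat"
  assumes "quadratic_local_field_extension v w \<iota> \<sigma>"
    and "even n"
    and "j \<in> carrier (GL TYPE('f) n)"
    and "transpose_mat j = - j"
  defines "J \<equiv> map_mat \<iota> j"
  shows "form_space \<sigma> n J = orbit (form_group n J) (twisted_conj \<sigma> n) (1\<^sub>m n)
    \<and> orbits (form_group n J) (form_space \<sigma> n J) (twisted_conj \<sigma> n) = {form_space \<sigma> n J}"
proof -
  interpret quadratic_local_field_extension v w \<iota> \<sigma> by fact
  have j: "symplectic_gram n j"
    using assms(3,4) by (simp add: symplectic_gram_def carrier_GL_iff)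
  have one: "1\<^sub>m n \<in> form_space \<sigma> n J"
    using assms(3)
    by (auto simp: form_space_def carrier_form_group_iff J_def gal.mat_hom_one carrier_GL_iff)
  then show ?thesis
    using orbit_eq_form_space[OF j] unfolding J_def orbits_def by blast
qed

end
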